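(* Let $\mathcal C$ be a unital commutative real algebra with unit $I$ and let $A_0,A_1,B_0,B_1\in\mathcal C$ satisfy $A_0^2=A_1^2=B_0^2=B_1^2=I$. Define the CHSH element $$S_{\mathcal C}:=A_0B_0+A_0B_1+A_1B_0-A_1B_1\in\mathcal C.$$ Then: (a) every character $\chi:\mathcal C\to\mathbb R$ satisfies $|\chi(S_{\mathcal C})|\le 2$; (b) in any faithful representation of $\mathcal C$ by (commuting) diagonal matrices one has $\operatorname{spec}(S_{\mathcal C})\subset[-2,2]$ and $\|S_{\mathcal C}\|\le 2$; (c) in particular, every Kolmogorov hidden-variable model satisfies $|\langle S_{\mathrm{cl}}\rangle|\le 2$.
   Context: A character of $\mathcal C$ is a unital real-algebra homomorphism $\chi:\mathcal C\to\mathbb R$. A faithful diagonal matrix representation is an injective unital algebra homomorphism from $\mathcal C$ into the diagonal real $N\times N$ matrices for some $N$; the spectrum and norm of $S_{\mathcal C}$ in it are the set of eigenvalues and the operator norm of its image. A Kolmogorov hidden-variable model consists of a probability space $(\Lambda,\rho)$ and four jointly defined $\{\pm1\}$-valued random variables $A_0,A_1,B_0,B_1$ on it; $S_{\mathrm{cl}}:=A_0B_0+A_0B_1+A_1B_0-A_1B_1$ and $\langle\cdot\rangle$ denotes expectation with respect to $\rho$. *)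

theory Defs
  imports "HOL-Analysis.Analysis" "HOL-Probability.Probability"
begin

text \<open>
  A unital commutative real algebra is a type of sort
  \<open>{real_algebra, comm_monoid_mult}\<close>, with unit \<open>1\<close>. The sort
  \<open>{real_algebra_1, comm_ring_1}\<close> is not used because it would require \<open>0 \<noteq> 1\<close>
  and thus exclude the zero algebra.
\<close>

definition chsh :: "'a::ring \<Rightarrow> 'a \<Rightarrow> 'a \<Rightarrow> 'a \<Rightarrow> 'a" where
  "chsh a0 a1 b0 b1 = a0 * b0 + a0 * b1 + a1 * b0 - a1 * b1"

definition is_character :: "('c::{real_algebra, comm_monoid_mult} \<Rightarrow> real) \<Rightarrow> bool" where
  "is_character \<xi> \<longleftrightarrow>
     linear \<xi> \<and> (\<forall>x y. \<xi> (x * y) = \<xi> x * \<xi> y) \<and> \<xi> 1 = 1"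

definition is_diagonal :: "real^'n^'n \<Rightarrow> bool" where
  "is_diagonal M \<longleftrightarrow> (\<forall>i j. i \<noteq> j \<longrightarrow> M $ i $ j = 0)"

definition faithful_diagonal_rep ::
    "('c::{real_algebra, comm_monoid_mult} \<Rightarrow> real^'n^'n) \<Rightarrow> bool" where
  "faithful_diagonal_rep \<phi> \<longleftrightarrow>
     linear \<phi> \<and> (\<forall>x y. \<phi> (x * y) = \<phi> x ** \<phi> y) \<and> \<phi> 1 = mat 1 \<and>
     inj \<phi> \<and> (\<forall>x. is_diagonal (\<phi> x))"

definition spec :: "real^'n^'n \<Rightarrow> real set" where
  "spec M = {l. \<exists>v. v \<noteq> 0 \<and> M *v v = l *s v}"

text \<open>The norm on \<open>real^'n\<close> is Euclidean, so this is the usual operator norm.\<close>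

definition op_norm :: "real^'n^'n \<Rightarrow> real" where
  "op_norm M = onorm ((*v) M)"

definition kolmogorov_hv_model ::
    "'m measure \<Rightarrow> ('m \<Rightarrow> real) \<Rightarrow> ('m \<Rightarrow> real) \<Rightarrow> ('m \<Rightarrow> real) \<Rightarrow> ('m \<Rightarrow> real) \<Rightarrow> bool" where
  "kolmogorov_hv_model \<rho> a0 a1 b0 b1 \<longleftrightarrow>
     prob_space \<rho> \<and>
     (\<forall>f \<in> {a0, a1, b0, b1}. f \<in> borel_measurable \<rho> \<and> (\<forall>\<omega> \<in> space \<rho>. f \<omega> \<in> {-1, 1}))"

end

theory Submission
  imports Defs
begin

text \<open>
  A character maps each of the four elements to a square root of \<open>1\<close> in \<open>\<real>\<close>, hence to \<open>\<plusminus>1\<close>, and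
  for signs one of \<open>b0 + b1\<close>, \<open>b0 - b1\<close> vanishes while the other is \<open>\<plusminus>2\<close>. In a diagonal
  representation every diagonal entry is a character, so the second part reduces to the first.
  In a hidden-variable model the bound holds pointwise and integrates.
\<close>

lemma abs_chsh_signs_le:
  fixes a0 a1 b0 b1 :: real
  assumes "a0 \<in> {-1, 1}" "a1 \<in> {-1, 1}" "b0 \<in> {-1, 1}" "b1 \<in> {-1, 1}"
  shows "\<bar>chsh a0 a1 b0 b1\<bar> \<le> 2"
  using assms by (auto simp: chsh_def)

lemma is_character_chsh:
  assumes "is_character \<xi>"
  shows "\<xi> (chsh a0 a1 b0 b1) = chsh (\<xi> a0) (\<xi> a1) (\<xi> b0) (\<xi> b1)"
  using assms by (simp add: is_character_def chsh_def linear_add linear_diff)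

lemma is_character_involution:
  assumes "is_character \<xi>" "x\<^sup>2 = 1"
  shows "\<xi> x \<in> {-1, 1}"
proof -
  have "\<xi> x * \<xi> x = \<xi> (x * x)"
    using assms by (simp add: is_character_def)
  also have "\<dots> = 1"
    using assms by (simp add: is_character_def flip: power2_eq_square)
  finally show ?thesis
    by (simp add: square_eq_1_iff disj_commute)
qed

lemma abs_is_character_chsh_le:
  assumes "is_character \<xi>" "A0\<^sup>2 = 1" "A1\<^sup>2 = 1" "B0\<^sup>2 = 1" "B1\<^sup>2 = 1"
  shows "\<bar>\<xi> (chsh A0 A1 B0 B1)\<bar> \<le> 2"
  unfolding is_character_chsh[OF assms(1)]
  by (intro abs_chsh_signs_le is_character_involution assms)

text \<open>Row \<open>i\<close> of \<open>M\<close> has only its diagonal entry, so one term of the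
  sum survives. The case \<open>j = i\<close> makes each diagonal entry multiplicative on diagonal
  matrices.\<close>

lemma is_diagonal_mult_entry:
  assumes "is_diagonal M"
  shows "(M ** N) $ i $ j = M $ i $ i * N $ i $ j"
proof -
  have "(\<Sum>k\<in>UNIV. M $ i $ k * N $ k $ j) = (\<Sum>k\<in>UNIV. if k = i then M $ i $ i * N $ i $ j else 0)"
    using assms by (intro sum.cong) (auto simp: is_diagonal_def)
  then show ?thesis
    by (simp add: matrix_matrix_mult_def)
qed

lemma is_diagonal_mult_vec_entry:
  assumes "is_diagonal M"
  shows "(M *v v) $ i = M $ i $ i * v $ i"
proof -
  have "(\<Sum>k\<in>UNIV. M $ i $ k * v $ k) = (\<Sum>k\<in>UNIV. if k = i then M $ i $ i * v $ i else 0)"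
    using assms by (intro sum.cong) (auto simp: is_diagonal_def)
  then show ?thesis
    by (simp add: matrix_vector_mult_def)
qed

text \<open>Reading off a coordinate is linear, diagonal matrices multiply entrywise along the
  diagonal, and \<open>mat 1\<close> has ones there.\<close>

lemma diagonal_entry_is_character:
  assumes "faithful_diagonal_rep \<phi>"
  shows "is_character (\<lambda>x. \<phi> x $ i $ i)"
proof -
  have "linear \<phi>"
    using assms by (simp add: faithful_diagonal_rep_def)
  then have "linear (\<lambda>x. \<phi> x $ i $ i)"
    by (intro linearI) (simp_all add: linear_add linear_cmul)
  then show ?thesis
    using assms
    by (simp add: is_character_def faithful_diagonal_rep_def is_diagonal_mult_entry mat_def)
qed

text \<open>An eigenvector has a nonzero coordinate; comparing both sides of the eigenvalue equation
  there and cancelling identifies the eigenvalue.\<close>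

lemma spec_diagonal_subset:
  assumes "is_diagonal M"
  shows "spec M \<subseteq> range (\<lambda>i. M $ i $ i)"
proof
  fix l assume "l \<in> spec M"
  then obtain v where v: "v \<noteq> 0" "M *v v = l *s v"
    by (auto simp: spec_def)
  then obtain i where "v $ i \<noteq> 0"
    by (auto simp: vec_eq_iff)
  moreover have "M $ i $ i * v $ i = l * v $ i"
    by (simp add: v(2) flip: is_diagonal_mult_vec_entry[OF assms])
  ultimately have "l = M $ i $ i"
    by simp
  then show "l \<in> range (\<lambda>i. M $ i $ i)"
    by blast
qed

text \<open>A diagonal matrix scales each coordinate by a factor of size at most \<open>c\<close>,
  and the Euclidean norm is monotone in the absolute values of the coordinates.\<close>

lemma op_norm_diagonal_le:
  assumes "is_diagonal M" and bound: "\<And>i. \<bar>M $ i $ i\<bar> \<le> c"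
  shows "op_norm M \<le> c"
  unfolding op_norm_def
proof (rule onorm_le)
  fix v
  \<comment> \<open>The index type is nonempty, so \<open>undefined\<close> serves as some index,
    and \<open>c\<close> dominates an absolute value.\<close>
  have c: "0 \<le> c"
    using bound[of undefined] by linarith
  have "norm (M *v v) \<le> norm (c *\<^sub>R v)"
    by (rule norm_le_componentwise_cart)
      (simp add: is_diagonal_mult_vec_entry[OF assms(1)] abs_mult c mult_right_mono bound)
  then show "norm (M *v v) \<le> c * norm v"
    using c by simp
qed

lemma kolmogorov_abs_expectation_chsh_le:
  assumes "kolmogorov_hv_model \<rho> a0 a1 b0 b1"
  shows "\<bar>prob_space.expectation \<rho> (\<lambda>\<omega>. chsh (a0 \<omega>) (a1 \<omega>) (b0 \<omega>) (b1 \<omega>))\<bar> \<le> 2"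
proof -
  interpret prob_space \<rho>
    using assms by (simp add: kolmogorov_hv_model_def)
  let ?S = "\<lambda>\<omega>. chsh (a0 \<omega>) (a1 \<omega>) (b0 \<omega>) (b1 \<omega>)"
  have [measurable]: "a0 \<in> borel_measurable \<rho>" "a1 \<in> borel_measurable \<rho>"
      "b0 \<in> borel_measurable \<rho>" "b1 \<in> borel_measurable \<rho>"
    using assms by (auto simp: kolmogorov_hv_model_def)
  \<comment> \<open>The variables share one sample space, so each outcome fixes all four signs at
    once.\<close>
  have bound: "\<bar>?S \<omega>\<bar> \<le> 2" if "\<omega> \<in> space \<rho>" for \<omega>
    using assms that by (intro abs_chsh_signs_le) (auto simp: kolmogorov_hv_model_def)
  have "?S \<in> borel_measurable \<rho>"
    unfolding chsh_def by measurable
  \<comment> \<open>A bounded measurable function is integrable because the total mass is finite;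
    since that mass is 1, the bound 2 later passes unchanged to the expectation.\<close>
  then have int: "integrable \<rho> ?S"
    using bound by (intro integrable_const_bound[where B = 2]) auto
  have "\<bar>expectation ?S\<bar> \<le> expectation (\<lambda>\<omega>. \<bar>?S \<omega>\<bar>)"
    by (rule integral_abs_bound)
  also have "\<dots> \<le> 2"
    using int bound by (intro integral_le_const) auto
  finally show ?thesis .
qed

theorem theorem7p1:
  fixes A0 A1 B0 B1 :: "'c::{real_algebra, comm_monoid_mult}"
  assumes "A0\<^sup>2 = 1" and "A1\<^sup>2 = 1" and "B0\<^sup>2 = 1" and "B1\<^sup>2 = 1"
  shows "(\<forall>\<xi> :: 'c \<Rightarrow> real. is_character \<xi> \<longrightarrow> \<bar>\<xi> (chsh A0 A1 B0 B1)\<bar> \<le> 2) \<and>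
    (\<forall>\<phi> :: 'c \<Rightarrow> real^'n^'n. faithful_diagonal_rep \<phi> \<longrightarrow>
        spec (\<phi> (chsh A0 A1 B0 B1)) \<subseteq> {-2..2} \<and> op_norm (\<phi> (chsh A0 A1 B0 B1)) \<le> 2) \<and>
    (\<forall>(\<rho> :: 'm measure) a0 a1 b0 b1. kolmogorov_hv_model \<rho> a0 a1 b0 b1 \<longrightarrow>
        \<bar>prob_space.expectation \<rho> (\<lambda>\<omega>. chsh (a0 \<omega>) (a1 \<omega>) (b0 \<omega>) (b1 \<omega>))\<bar> \<le> 2)"
proof (intro conjI allI impI)
  show "\<bar>\<xi> (chsh A0 A1 B0 B1)\<bar> \<le> 2" if "is_character \<xi>" for \<xi>
    using abs_is_character_chsh_le[OF that assms] .
next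
  fix \<phi> :: "'c \<Rightarrow> real^'n^'n"
  assume rep: "faithful_diagonal_rep \<phi>"
  let ?M = "\<phi> (chsh A0 A1 B0 B1)"
  have diag: "is_diagonal ?M"
    using rep by (simp add: faithful_diagonal_rep_def)
  have entry: "\<bar>?M $ i $ i\<bar> \<le> 2" for i
    using abs_is_character_chsh_le[OF diagonal_entry_is_character[OF rep] assms] .
  have "?M $ i $ i \<in> {-2..2}" for i
    using entry[of i] by (simp add: abs_le_iff)
  then show "spec ?M \<subseteq> {-2..2}"
    using spec_diagonal_subset[OF diag] by blast
  show "op_norm ?M \<le> 2"
    using op_norm_diagonal_le[OF diag entry] .
next
  fix \<rho> :: "'m measure" and a0 a1 b0 b1
  assume "kolmogorov_hv_model \<rho> a0 a1 b0 b1"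
  then show "\<bar>prob_space.expectation \<rho> (\<lambda>\<omega>. chsh (a0 \<omega>) (a1 \<omega>) (b0 \<omega>) (b1 \<omega>))\<bar> \<le> 2"
    by (rule kolmogorov_abs_expectation_chsh_le)
qed

end
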